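(* Let $A$ be a real $n\times n$ matrix that is a singular irreducible $M$-matrix. Then $A$ is trivially range monotone; that is, for every $x\in R(A)$, $Ax\ge 0$ implies $x=0$.
   Context: For vectors and matrices, $\geq 0$ means that all entries are nonnegative. $R(A)$ denotes the range space of $A$, and $\rho(B)$ the spectral radius of $B$. A real square matrix $A$ is a $Z$-matrix if all its off-diagonal entries are nonpositive; any $Z$-matrix can be written as $A=sI-B$ with $s\ge 0$ and $B\ge 0$. If $s\ge\rho(B)$, then $A$ is called an $M$-matrix; a singular $M$-matrix is an $M$-matrix that is not invertible. A real $n\times n$ matrix $A$ is reducible if there is a permutation matrix $P$ such that $P^TAP=\begin{bmatrix} S_{11} & S_{12}\\ 0 & S_{22}\end{bmatrix}$ for some square matrices $S_{11},S_{22}$ of order at least one; it is irreducible if it is not reducible. *)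

theory Defs
  imports
    "Jordan_Normal_Form.Spectral_Radius"
    "Jordan_Normal_Form.Matrix_Comparison"
begin

definition range_space :: "real mat \<Rightarrow> real vec set" where
  "range_space A = (\<lambda>v. A *\<^sub>v v) ` carrier_vec (dim_col A)"

definition Z_matrix :: "real mat \<Rightarrow> bool" where
  "Z_matrix A \<longleftrightarrow> square_mat A \<and>
     (\<forall>i < dim_row A. \<forall>j < dim_col A. i \<noteq> j \<longrightarrow> A $$ (i, j) \<le> 0)"

text \<open>The value \<open>s - \<rho>(B)\<close> is the same for every representation \<open>A = s I - B\<close> with
  \<open>B \<ge> 0\<close>, so it suffices to ask for one representation. The library's spectral radius is
  the maximal modulus of the complex eigenvalues, hence the embedding of \<open>B\<close> into the
  complex matrices. For order 0 that maximum is unspecified, but the empty matrix is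
  invertible, so this does not affect singular M-matrices.\<close>

definition M_matrix :: "real mat \<Rightarrow> bool" where
  "M_matrix A \<longleftrightarrow> Z_matrix A \<and>
     (\<exists>s B. s \<ge> 0 \<and> B \<in> carrier_mat (dim_row A) (dim_row A) \<and>
        B \<ge>\<^sub>m 0\<^sub>m (dim_row A) (dim_row A) \<and>
        A = s \<cdot>\<^sub>m 1\<^sub>m (dim_row A) - B \<and>
        s \<ge> spectral_radius (map_mat complex_of_real B))"

definition singular_M_matrix :: "real mat \<Rightarrow> bool" where
  "singular_M_matrix A \<longleftrightarrow> M_matrix A \<and> \<not> invertible_mat A"

definition permutation_matrix :: "nat \<Rightarrow> real mat \<Rightarrow> bool" where
  "permutation_matrix n P \<longleftrightarrow>
     (\<exists>\<pi>. \<pi> permutes {0..<n} \<and> P = mat n n (\<lambda>(i, j). if i = \<pi> j then 1 else 0))"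

definition reducible_mat :: "real mat \<Rightarrow> bool" where
  "reducible_mat A \<longleftrightarrow> square_mat A \<and>
     (\<exists>P k m S11 S12 S22. permutation_matrix (dim_row A) P \<and> k \<ge> 1 \<and> m \<ge> 1 \<and>
        S11 \<in> carrier_mat k k \<and> S12 \<in> carrier_mat k m \<and> S22 \<in> carrier_mat m m \<and>
        transpose_mat P * A * P = four_block_mat S11 S12 (0\<^sub>m m k) S22)"

definition irreducible_mat :: "real mat \<Rightarrow> bool" where
  "irreducible_mat A \<longleftrightarrow> square_mat A \<and> \<not> reducible_mat A"

definition trivially_range_monotone :: "real mat \<Rightarrow> bool" where
  "trivially_range_monotone A \<longleftrightarrow>
     (\<forall>x \<in> range_space A. A *\<^sub>v x \<ge> 0\<^sub>v (dim_row A) \<longrightarrow> x = 0\<^sub>v (dim_row A))"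

end

theory Submission
  imports Defs
begin

text \<open>Write \<open>A = s I - B\<close>. If \<open>v \<ge> 0\<close> and \<open>B v \<ge> s v\<close> with \<open>B v \<noteq> s v\<close>, then repeatedly
  replacing \<open>v\<close> by \<open>(I + B) v\<close> enlarges the support of the defect \<open>B v - s v\<close>, by
  irreducibility, until it is strictly positive. Then \<open>B v \<ge> t v\<close> for some \<open>t > s\<close>, so the powers
  of \<open>B\<close> grow like \<open>t^k\<close>, contradicting \<open>\<rho>(B) \<le> s\<close>. Hence \<open>B v = s v\<close>.
  Applied to absolute values, this shows that the null space of \<open>A\<close> is spanned by a
  strictly positive vector \<open>p\<close>. If \<open>A x \<ge> 0\<close>, then \<open>v = c p - x\<close> is nonnegative for large
  \<open>c\<close> and satisfies \<open>B v \<ge> s v\<close>, so \<open>A x = 0\<close>. Finally \<open>x = A z\<close> is then a multiple of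
  \<open>p\<close>, so \<open>A z \<ge> 0\<close> or \<open>A (- z) \<ge> 0\<close>, and the same argument gives \<open>A z = 0\<close>.\<close>

section \<open>Irreducibility as connectedness of index sets\<close>

lemma ex_permutes_image:
  assumes "S \<subseteq> {0..<n}"
  shows "\<exists>\<pi>. \<pi> permutes {0..<n} \<and> \<pi> ` {0..<card S} = S"
proof -
  have fS: "finite S" using assms finite_subset by blast
  have le: "card S \<le> n" using card_mono[OF _ assms] by simp
  obtain f where f: "bij_betw f {0..<card S} S"
    using ex_bij_betw_nat_finite[OF fS] by blast
  have "card {card S..<n} = card ({0..<n} - S)"
    using card_Diff_subset[OF fS assms] by simp
  then obtain g where g: "bij_betw g {card S..<n} ({0..<n} - S)"
    using finite_same_card_bij[of "{card S..<n}" "{0..<n} - S"] by auto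
  \<comment> \<open>\<open>f\<close> fills the first \<open>card S\<close> positions with
    \<open>S\<close> and \<open>g\<close> the remaining ones with its complement; the last branch is
    the identity outside \<open>{0..<n}\<close>, as \<open>permutes\<close> demands.\<close>
  define \<pi> where "\<pi> i = (if i < card S then f i else if i < n then g i else i)" for i
  have 1: "bij_betw \<pi> {0..<card S} S"
    using f by (rule bij_betw_cong[THEN iffD1, rotated]) (simp add: \<pi>_def)
  have 2: "bij_betw \<pi> {card S..<n} ({0..<n} - S)"
    using g by (rule bij_betw_cong[THEN iffD1, rotated]) (simp add: \<pi>_def)
  have "bij_betw \<pi> ({0..<card S} \<union> {card S..<n}) (S \<union> ({0..<n} - S))"
    using bij_betw_combine[OF 1 2] by blast
  moreover have "{0..<card S} \<union> {card S..<n} = {0..<n}" using le by auto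
  moreover have "S \<union> ({0..<n} - S) = {0..<n}" using assms by auto
  ultimately have "bij_betw \<pi> {0..<n} {0..<n}" by simp
  moreover have "\<pi> i = i" if "i \<notin> {0..<n}" for i using that le by (simp add: \<pi>_def)
  ultimately have "\<pi> permutes {0..<n}" by (rule bij_imp_permutes)
  with 1 show ?thesis by (auto simp: bij_betw_def)
qed

text \<open>Column \<open>j\<close> of \<open>P\<close> is the unit vector at
  \<open>\<pi> j\<close>, so each of the two products selects a single summand. With this convention
  \<open>\<pi>\<close> itself appears in the result and not its inverse.\<close>

lemma index_permutation_conj:
  fixes A :: "'a :: comm_semiring_1 mat"
  assumes A: "A \<in> carrier_mat n n" and \<pi>: "\<pi> permutes {0..<n}"
    and P: "P = mat n n (\<lambda>(i, j). if i = \<pi> j then 1 else 0)"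
    and i: "i < n" and j: "j < n"
  shows "(transpose_mat P * A * P) $$ (i, j) = A $$ (\<pi> i, \<pi> j)"
proof -
  have \<pi>n: "\<pi> k < n" if "k < n" for k using permutes_in_image[OF \<pi>, of k] that by simp
  have L: "(transpose_mat P * A) $$ (i, k) = A $$ (\<pi> i, k)" if k: "k < n" for k
  proof -
    have "(transpose_mat P * A) $$ (i, k) =
        (\<Sum>l\<in>{0..<n}. (if l = \<pi> i then 1 else 0) * A $$ (l, k))"
      using A i k by (auto simp: P scalar_prod_def intro!: sum.cong)
    also have "\<dots> = (\<Sum>l\<in>{0..<n}. if l = \<pi> i then A $$ (l, k) else 0)"
      by (intro sum.cong) auto
    also have "\<dots> = A $$ (\<pi> i, k)" using \<pi>n[OF i] by simp
    finally show ?thesis .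
  qed
  have "(transpose_mat P * A * P) $$ (i, j) =
      (\<Sum>k\<in>{0..<n}. (transpose_mat P * A) $$ (i, k) * (if k = \<pi> j then 1 else 0))"
    using A i j by (auto simp: P scalar_prod_def intro!: sum.cong)
  also have "\<dots> = (\<Sum>k\<in>{0..<n}. if k = \<pi> j then A $$ (\<pi> i, k) else 0)"
    by (intro sum.cong) (auto simp: L)
  also have "\<dots> = A $$ (\<pi> i, \<pi> j)" using \<pi>n[OF j] by simp
  finally show ?thesis .
qed

text \<open>If all entries with row outside \<open>S\<close> and column in \<open>S\<close>
  vanished, a permutation listing \<open>S\<close> first would move them into the lower left block
  and exhibit \<open>A\<close> as reducible. Later arguments use irreducibility only in this form,
  free of permutation matrices.\<close>

lemma irreducible_mat_connects:
  assumes A: "A \<in> carrier_mat n n" and irr: "irreducible_mat A"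
    and S: "S \<subset> {0..<n}" "S \<noteq> {}"
  shows "\<exists>i\<in>{0..<n} - S. \<exists>j\<in>S. A $$ (i, j) \<noteq> 0"
proof (rule ccontr)
  assume "\<not> ?thesis"
  then have zero: "A $$ (i, j) = 0" if "i \<in> {0..<n} - S" "j \<in> S" for i j using that by blast
  obtain \<pi> where \<pi>: "\<pi> permutes {0..<n}" and im: "\<pi> ` {0..<card S} = S"
    using ex_permutes_image[of S n] S by blast
  define P :: "real mat" where "P = mat n n (\<lambda>(i, j). if i = \<pi> j then 1 else 0)"
  define k where "k = card S"
  define M where "M = transpose_mat P * A * P"
  have fS: "finite S" using S finite_subset by blast
  have k: "k \<ge> 1" using S fS by (simp add: k_def Suc_le_eq card_gt_0_iff)
  have kn: "k < n" using psubset_card_mono[OF _ S(1)] by (simp add: k_def)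
  have M: "M \<in> carrier_mat n n" by (simp add: M_def P_def carrier_matI)
  have z: "M $$ (i, j) = 0" if i: "k \<le> i" "i < n" and j: "j < k" for i j
  proof -
    \<comment> \<open>The first \<open>k\<close> positions already exhaust \<open>S\<close>, and
      \<open>\<pi>\<close> is injective.\<close>
    have "\<pi> i \<notin> S"
    proof
      assume "\<pi> i \<in> S"
      then have "\<pi> i \<in> \<pi> ` {0..<k}" by (simp add: im k_def)
      then obtain l where "l < k" "\<pi> i = \<pi> l" by auto
      then have "i = l" using permutes_inj[OF \<pi>] by (simp add: inj_eq)
      with \<open>l < k\<close> i show False by simp
    qed
    moreover have "\<pi> i < n" using permutes_in_image[OF \<pi>, of i] i by simp
    moreover have "\<pi> j \<in> S" using im j by (auto simp: k_def)
    ultimately have "A $$ (\<pi> i, \<pi> j) = 0" by (intro zero) auto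
    then show ?thesis
      using index_permutation_conj[OF A \<pi> P_def, of i j] i j kn by (simp add: M_def)
  qed
  define S11 S12 S22 where "S11 = mat k k (($$) M)"
    and "S12 = mat k (n - k) (\<lambda>(i, j). M $$ (i, j + k))"
    and "S22 = mat (n - k) (n - k) (\<lambda>(i, j). M $$ (i + k, j + k))"
  have "M = four_block_mat S11 S12 (0\<^sub>m (n - k) k) S22"
    by (rule eq_matI) (use M kn z in \<open>auto simp: S11_def S12_def S22_def\<close>)
  moreover have "S11 \<in> carrier_mat k k" "S12 \<in> carrier_mat k (n - k)"
      "S22 \<in> carrier_mat (n - k) (n - k)"
    by (simp_all add: S11_def S12_def S22_def)
  moreover have "permutation_matrix (dim_row A) P"
    unfolding permutation_matrix_def P_def using \<pi> A by blast
  moreover have "n - k \<ge> 1" "square_mat A" using kn A by auto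
  ultimately have "reducible_mat A"
    unfolding reducible_mat_def M_def using k by blast
  with irr show False by (simp add: irreducible_mat_def)
qed

section \<open>Spectral radius and growth of powers\<close>

lemma spectral_radius_divide_less_1:
  fixes B :: "complex mat"
  assumes B: "B \<in> carrier_mat n n" and n: "n > 0" and r: "spectral_radius B < r"
  shows "spectral_radius (complex_of_real (1 / r) \<cdot>\<^sub>m B) < 1"
proof -
  let ?C = "complex_of_real (1 / r) \<cdot>\<^sub>m B"
  have C: "?C \<in> carrier_mat n n" using B by simp
  have "spectral_radius B \<in> norm ` spectrum B" by (rule spectral_radius_mem_max[OF B n])
  then have r0: "r > 0" using r by (metis imageE le_less_trans norm_ge_zero)
  obtain k where k: "k \<in> spectrum ?C" and sr: "spectral_radius ?C = norm k"
    using spectral_radius_mem_max(1)[OF C n] by blast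
  then obtain v where v: "v \<in> carrier_vec n" "v \<noteq> 0\<^sub>v n" and ev: "?C *\<^sub>v v = k \<cdot>\<^sub>v v"
    using B by (auto simp: spectrum_def eigenvalue_def eigenvector_def)
  \<comment> \<open>Undoing the scaling turns an eigenvalue \<open>k\<close> of the scaled matrix
    into the eigenvalue \<open>r * k\<close> of \<open>B\<close>, with the same eigenvector.\<close>
  have "B *\<^sub>v v = (complex_of_real r * k) \<cdot>\<^sub>v v"
  proof (rule eq_vecI)
    fix i assume "i < dim_vec ((complex_of_real r * k) \<cdot>\<^sub>v v)"
    then have i: "i < n" using v by simp
    have "(?C *\<^sub>v v) $ i = (k \<cdot>\<^sub>v v) $ i" by (simp only: ev)
    then show "(B *\<^sub>v v) $ i = ((complex_of_real r * k) \<cdot>\<^sub>v v) $ i"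
      using i v B r0 by (auto simp: field_simps)
  qed (use B v in auto)
  then have "complex_of_real r * k \<in> spectrum B"
    using v B by (auto simp: spectrum_def eigenvalue_def eigenvector_def)
  then have "norm (complex_of_real r * k) \<le> spectral_radius B"
    by (intro spectral_radius_mem_max(2)[OF B n] imageI)
  then have "r * norm k \<le> spectral_radius B" using r0 by (simp add: norm_mult)
  with r have "r * norm k < r * 1" by linarith
  with r0 have "norm k < 1" by (simp only: mult_less_cancel_left_pos)
  then show ?thesis by (simp only: sr)
qed

lemma mult_mat_vec_nonneg:
  fixes D :: "real mat"
  assumes "D \<in> carrier_mat n n" "u \<in> carrier_vec n"
    and "\<And>i j. i < n \<Longrightarrow> j < n \<Longrightarrow> 0 \<le> D $$ (i, j)" and "\<And>i. i < n \<Longrightarrow> 0 \<le> u $ i" and "i < n"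
  shows "0 \<le> (D *\<^sub>v u) $ i"
  using assms by (auto simp: scalar_prod_def intro!: sum_nonneg)

lemma mult_mat_vec_mono:
  fixes D :: "real mat"
  assumes "D \<in> carrier_mat n n" "u \<in> carrier_vec n" "w \<in> carrier_vec n"
    and "\<And>i j. i < n \<Longrightarrow> j < n \<Longrightarrow> 0 \<le> D $$ (i, j)" and "\<And>i. i < n \<Longrightarrow> u $ i \<le> w $ i" and "i < n"
  shows "(D *\<^sub>v u) $ i \<le> (D *\<^sub>v w) $ i"
  using assms by (auto simp: scalar_prod_def intro!: sum_mono mult_left_mono)

text \<open>The induction peels off the rightmost factor of the power. As \<open>D\<close> preserves
  entrywise inequalities, \<open>D *\<^sub>v u\<close> satisfies the same growth condition as
  \<open>u\<close>, which is why \<open>u\<close> is generalized.\<close>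

lemma pow_mat_vec_growth:
  fixes D :: "real mat"
  assumes D: "D \<in> carrier_mat n n" and nonneg: "\<And>i j. i < n \<Longrightarrow> j < n \<Longrightarrow> 0 \<le> D $$ (i, j)"
    and q: "0 \<le> q"
  shows "u \<in> carrier_vec n \<Longrightarrow> \<forall>i<n. q * u $ i \<le> (D *\<^sub>v u) $ i \<Longrightarrow> i < n \<Longrightarrow>
    q ^ k * u $ i \<le> (D ^\<^sub>m k *\<^sub>v u) $ i"
proof (induction k arbitrary: u)
  case 0
  then show ?case using D by simp
next
  case (Suc k)
  define w where "w = D *\<^sub>v u"
  have w: "w \<in> carrier_vec n" using D Suc.prems by (auto simp: w_def)
  have "q * w $ i \<le> (D *\<^sub>v w) $ i" if i: "i < n" for i
  proof -
    have "(D *\<^sub>v (q \<cdot>\<^sub>v u)) $ i \<le> (D *\<^sub>v w) $ i"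
      using Suc.prems by (intro mult_mat_vec_mono[OF D _ w nonneg]) (auto simp: w_def i)
    then show ?thesis using D Suc.prems i by (simp add: w_def mult_mat_vec)
  qed
  then have "q ^ k * w $ i \<le> (D ^\<^sub>m k *\<^sub>v w) $ i" using Suc.IH[OF w] Suc.prems by blast
  moreover have "D ^\<^sub>m k *\<^sub>v w = D ^\<^sub>m Suc k *\<^sub>v u"
    using D Suc.prems(1) by (simp add: w_def assoc_mult_mat_vec[of _ n n _ n])
  moreover have "q ^ k * (q * u $ i) \<le> q ^ k * w $ i"
    using Suc.prems q by (intro mult_left_mono) (auto simp: w_def)
  ultimately show ?case by (simp add: mult.assoc mult.left_commute)
qed

text \<open>Otherwise some \<open>r\<close> lies strictly between the spectral radius and
  \<open>t\<close>. Scaling by \<open>1 / r\<close> brings the radius below 1, so all powers of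
  \<open>D\<close> have entries bounded by one constant. At a positive coordinate of
  \<open>u\<close>, however, \<open>D ^\<^sub>m k *\<^sub>v u\<close> grows at least like
  \<open>(t / r) ^ k\<close> with \<open>t / r > 1\<close>.\<close>

lemma spectral_radius_ge_of_growth:
  fixes B :: "real mat"
  assumes B: "B \<in> carrier_mat n n" and nonneg: "\<And>i j. i < n \<Longrightarrow> j < n \<Longrightarrow> 0 \<le> B $$ (i, j)"
    and u: "u \<in> carrier_vec n" and u0: "\<And>i. i < n \<Longrightarrow> 0 \<le> u $ i" and u_nz: "u \<noteq> 0\<^sub>v n"
    and growth: "\<And>i. i < n \<Longrightarrow> t * u $ i \<le> (B *\<^sub>v u) $ i"
  shows "t \<le> spectral_radius (map_mat complex_of_real B)"
proof (rule ccontr)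
  let ?B = "map_mat complex_of_real B"
  assume "\<not> ?thesis"
  then have "spectral_radius ?B < t" by simp
  then obtain r where r: "spectral_radius ?B < r" "r < t" using dense by blast
  obtain l where l: "l < n" "u $ l > 0"
  proof -
    have "\<exists>l<n. u $ l \<noteq> 0" using u u_nz by (metis carrier_vecD eq_vecI index_zero_vec)
    then show ?thesis using u0 that by (metis order_le_imp_less_or_eq)
  qed
  then have n: "n > 0" by simp
  have BC: "?B \<in> carrier_mat n n" using B by simp
  have "spectral_radius ?B \<in> norm ` spectrum ?B" by (rule spectral_radius_mem_max[OF BC n])
  then have r0: "r > 0" using r by (metis imageE le_less_trans norm_ge_zero)
  define D where "D = (1 / r) \<cdot>\<^sub>m B"
  have D: "D \<in> carrier_mat n n" using B by (simp add: D_def)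
  have mapD: "map_mat complex_of_real D = complex_of_real (1 / r) \<cdot>\<^sub>m ?B"
    by (rule eq_matI) (auto simp: D_def)
  obtain c where c: "\<And>k. norm_bound (map_mat complex_of_real D ^\<^sub>m k) c"
    using spectral_radius_jnf_norm_bound_less_1_upper_triangular[of _ n,
        OF _ spectral_radius_divide_less_1[OF BC n r(1)]] BC
    unfolding mapD by (meson smult_carrier_mat)
  have bound: "(D ^\<^sub>m k) $$ (i, j) \<le> c" if "i < n" "j < n" for k i j
  proof -
    have "map_mat complex_of_real D ^\<^sub>m k = map_mat complex_of_real (D ^\<^sub>m k)"
      using of_real_hom.mat_hom_pow[OF D] by metis
    then have "norm (complex_of_real ((D ^\<^sub>m k) $$ (i, j))) \<le> c"
      using c[of k] that D by (auto simp: norm_bound_def)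
    then show ?thesis by simp
  qed
  have Dg: "\<forall>i<n. (t / r) * u $ i \<le> (D *\<^sub>v u) $ i"
    using growth B u r0 by (auto simp: D_def divide_right_mono)
  have "(t / r) ^ k * u $ l \<le> (\<Sum>j\<in>{0..<n}. c * u $ j)" for k
  proof -
    have "(t / r) ^ k * u $ l \<le> (D ^\<^sub>m k *\<^sub>v u) $ l"
      using nonneg r0 r(2) B by (intro pow_mat_vec_growth[OF D _ _ u Dg l(1)]) (auto simp: D_def)
    also have "\<dots> = (\<Sum>j\<in>{0..<n}. (D ^\<^sub>m k) $$ (l, j) * u $ j)"
      using D u l pow_carrier_mat[OF D, of k] by (auto simp: scalar_prod_def)
    also have "\<dots> \<le> (\<Sum>j\<in>{0..<n}. c * u $ j)"
      using bound l u0 by (intro sum_mono mult_right_mono) auto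
    finally show ?thesis .
  qed
  then have le: "(t / r) ^ k \<le> (\<Sum>j\<in>{0..<n}. c * u $ j) / u $ l" for k
    using l by (simp only: pos_le_divide_eq)
  have "t / r > 1" using r r0 by simp
  then obtain k where "(\<Sum>j\<in>{0..<n}. c * u $ j) / u $ l < (t / r) ^ k"
    using real_arch_pow by blast
  with le[of k] show False by linarith
qed

section \<open>Perron-Frobenius arguments for an irreducible nonnegative matrix\<close>

locale irreducible_nonneg_mat =
  fixes B :: "real mat" and n :: nat and s :: real
  assumes B: "B \<in> carrier_mat n n" and n: "n > 0"
    and nonneg: "\<And>i j. i < n \<Longrightarrow> j < n \<Longrightarrow> 0 \<le> B $$ (i, j)"
    and connects: "\<And>S. S \<subset> {0..<n} \<Longrightarrow> S \<noteq> {} \<Longrightarrow> \<exists>i\<in>{0..<n} - S. \<exists>j\<in>S. B $$ (i, j) \<noteq> 0"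
    and radius: "spectral_radius (map_mat complex_of_real B) \<le> s"
begin

lemma mult_pos:
  assumes "v \<in> carrier_vec n" "\<And>i. i < n \<Longrightarrow> 0 \<le> v $ i"
    and "i < n" "j < n" "B $$ (i, j) \<noteq> 0" "v $ j > 0"
  shows "(B *\<^sub>v v) $ i > 0"
proof -
  have "0 < B $$ (i, j) * v $ j" using assms nonneg[of i j] by simp
  also have "\<dots> \<le> (\<Sum>j\<in>{0..<n}. B $$ (i, j) * v $ j)"
    using assms nonneg by (intro member_le_sum) auto
  also have "\<dots> = (B *\<^sub>v v) $ i" using assms B by (auto simp: scalar_prod_def)
  finally show ?thesis .
qed

text \<open>A defect positive in every coordinate leaves room to raise \<open>s\<close> to some
  \<open>s + e\<close> with \<open>e > 0\<close>, and the growth criterion then pushes the spectral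
  radius above \<open>s\<close>.\<close>

lemma no_pos_defect:
  assumes "v \<in> carrier_vec n" "\<And>i. i < n \<Longrightarrow> 0 \<le> v $ i"
    and pos: "\<And>i. i < n \<Longrightarrow> s * v $ i < (B *\<^sub>v v) $ i"
  shows False
proof -
  have "v \<noteq> 0\<^sub>v n"
  proof
    assume "v = 0\<^sub>v n"
    then show False using pos[OF n] B n by simp
  qed
  \<comment> \<open>The denominator \<open>v $ i + 1\<close> stays positive where
    \<open>v $ i = 0\<close>, and \<open>e * (v $ i + 1)\<close> still dominates the required
    \<open>e * v $ i\<close>.\<close>
  moreover define e where "e = Min ((\<lambda>i. ((B *\<^sub>v v) $ i - s * v $ i) / (v $ i + 1)) ` {0..<n})"
  moreover have "e > 0" unfolding e_def using n pos assms(2)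
    by (subst Min_gr_iff) (auto intro!: divide_pos_pos add_nonneg_pos)
  moreover have "(s + e) * v $ i \<le> (B *\<^sub>v v) $ i" if i: "i < n" for i
  proof -
    have "e \<le> ((B *\<^sub>v v) $ i - s * v $ i) / (v $ i + 1)"
      unfolding e_def using i by (intro Min_le) auto
    then have "e * (v $ i + 1) \<le> (B *\<^sub>v v) $ i - s * v $ i"
      using assms(2)[OF i] by (simp add: pos_le_divide_eq add_nonneg_pos)
    then show ?thesis using \<open>e > 0\<close> by (simp add: algebra_simps)
  qed
  ultimately have "s + e \<le> spectral_radius (map_mat complex_of_real B)"
    by (intro spectral_radius_ge_of_growth[OF B nonneg assms(1,2)])
  with \<open>e > 0\<close> radius show False by linarith
qed

text \<open>Induction on the number of coordinates where the defect \<open>z\<close> is not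
  positive. The defect is a variable of its own so that \<open>v\<close> and \<open>z\<close> can be
  replaced together; the case of full support is \<open>no_pos_defect\<close>.\<close>

lemma no_defect:
  "v \<in> carrier_vec n \<Longrightarrow> z \<in> carrier_vec n \<Longrightarrow> \<forall>i<n. 0 \<le> v $ i \<Longrightarrow> \<forall>i<n. 0 \<le> z $ i \<Longrightarrow>
    B *\<^sub>v v = s \<cdot>\<^sub>v v + z \<Longrightarrow> z = 0\<^sub>v n"
proof (induction "n - card {i\<in>{0..<n}. z $ i > 0}" arbitrary: v z rule: less_induct)
  case less
  let ?S = "{i\<in>{0..<n}. z $ i > 0}"
  show ?case
  proof (rule ccontr)
    assume z_nz: "z \<noteq> 0\<^sub>v n"
    then have "\<exists>l<n. z $ l \<noteq> 0"
      using less.prems(2) by (metis carrier_vecD eq_vecI index_zero_vec)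
    then have ne: "?S \<noteq> {}" using less.prems(4) by (auto simp: order_less_le)
    show False
    proof (cases "?S = {0..<n}")
      case True
      show False
      proof (rule no_pos_defect[OF less.prems(1)])
        fix i assume i: "i < n"
        then have "z $ i > 0" using True by (auto simp: set_eq_iff)
        then show "s * v $ i < (B *\<^sub>v v) $ i"
          using i less.prems(1,2) unfolding less.prems(5) by simp
      qed (use less.prems in auto)
    next
      case False
      then obtain i j where ij: "i \<in> {0..<n} - ?S" "j \<in> ?S" "B $$ (i, j) \<noteq> 0"
        using connects[of ?S] ne by blast
      \<comment> \<open>Both vectors are multiplied by \<open>I + B\<close>. It commutes with
        \<open>B\<close>, so the defect equation survives; it keeps the support of \<open>z\<close>
        and adds the index \<open>i\<close>.\<close>
      define v' z' where "v' = v + B *\<^sub>v v" and "z' = z + B *\<^sub>v z"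
      have Bv: "B *\<^sub>v v \<in> carrier_vec n" and Bz: "B *\<^sub>v z \<in> carrier_vec n"
        using B less.prems by auto
      have Bv0: "0 \<le> (B *\<^sub>v v) $ l" and Bz0: "0 \<le> (B *\<^sub>v z) $ l" if "l < n" for l
        using mult_mat_vec_nonneg[OF B] less.prems(1-4) nonneg that by blast+
      have Bzi: "(B *\<^sub>v z) $ i > 0"
        using ij less.prems by (intro mult_pos[of z i j]) auto
      have z': "z' $ l = z $ l + (B *\<^sub>v z) $ l" if "l < n" for l
        using that Bz B by (simp add: z'_def)
      have "insert i ?S \<subseteq> {l\<in>{0..<n}. z' $ l > 0}"
        using ij Bzi less.prems(4)
        by (auto simp: z' simp del: index_mult_mat_vec intro: add_pos_nonneg[OF _ Bz0] add_nonneg_pos)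
      then have "card (insert i ?S) \<le> card {l\<in>{0..<n}. z' $ l > 0}" by (intro card_mono) auto
      moreover have "card (insert i ?S) = Suc (card ?S)" using ij by (subst card_insert_disjoint) auto
      \<comment> \<open>The measure is a truncated difference, so a larger support decreases it
        strictly only below \<open>n\<close>.\<close>
      moreover have "card ?S < n"
      proof -
        have "?S \<subset> {0..<n}" using False by blast
        from psubset_card_mono[OF _ this] show ?thesis by simp
      qed
      ultimately have dec: "n - card {l\<in>{0..<n}. z' $ l > 0} < n - card ?S" by simp
      have eq: "B *\<^sub>v v' = s \<cdot>\<^sub>v v' + z'"
      proof -
        have "B *\<^sub>v v' = B *\<^sub>v v + B *\<^sub>v (B *\<^sub>v v)"
          unfolding v'_def using B Bv less.prems by (intro mult_add_distrib_mat_vec) auto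
        also have "B *\<^sub>v (B *\<^sub>v v) = B *\<^sub>v (s \<cdot>\<^sub>v v) + B *\<^sub>v z"
          using B less.prems by (simp add: mult_add_distrib_mat_vec[of _ n n])
        also have "B *\<^sub>v (s \<cdot>\<^sub>v v) = s \<cdot>\<^sub>v (B *\<^sub>v v)"
          using B less.prems by (simp add: mult_mat_vec)
        also have "B *\<^sub>v v + (s \<cdot>\<^sub>v (B *\<^sub>v v) + B *\<^sub>v z) =
            (s \<cdot>\<^sub>v v + z) + (s \<cdot>\<^sub>v (B *\<^sub>v v) + B *\<^sub>v z)" by (simp add: less.prems)
        also have "\<dots> = s \<cdot>\<^sub>v v' + z'"
          using less.prems(1,2) Bv Bz B
          by (intro eq_vecI) (auto simp: v'_def z'_def algebra_simps)
        finally show ?thesis .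
      qed
      have "z' = 0\<^sub>v n"
        by (rule less.hyps[OF dec _ _ _ _ eq])
          (use less.prems Bv Bz Bv0 Bz0 B in \<open>auto simp: v'_def z'_def simp del: index_mult_mat_vec\<close>)
      then have "z' $ i = 0" using ij by auto
      then show False using z'[of i] Bzi ij less.prems(4) by (auto simp del: index_mult_mat_vec)
    qed
  qed
qed

lemma super_eigenvector:
  assumes v: "v \<in> carrier_vec n" "\<And>i. i < n \<Longrightarrow> 0 \<le> v $ i"
    and le: "\<And>i. i < n \<Longrightarrow> s * v $ i \<le> (B *\<^sub>v v) $ i"
  shows "B *\<^sub>v v = s \<cdot>\<^sub>v v"
proof -
  define z where "z = B *\<^sub>v v - s \<cdot>\<^sub>v v"
  have z: "z \<in> carrier_vec n" using v B by (auto simp: z_def)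
  have eq: "B *\<^sub>v v = s \<cdot>\<^sub>v v + z" using v B by (intro eq_vecI) (auto simp: z_def)
  have "z = 0\<^sub>v n"
    by (rule no_defect[OF v(1) z _ _ eq])
      (use v le B in \<open>auto simp: z_def simp del: index_mult_mat_vec\<close>)
  then show ?thesis using eq v by simp
qed

text \<open>If the support were proper, irreducibility would give a row \<open>k\<close> outside it
  with a nonzero entry in a column of the support. Then \<open>B *\<^sub>v v\<close> is positive at
  \<open>k\<close>, whereas \<open>s * v $ k = 0\<close>.\<close>

lemma nonneg_eigenvector_pos:
  assumes v: "v \<in> carrier_vec n" "\<And>i. i < n \<Longrightarrow> 0 \<le> v $ i" "v \<noteq> 0\<^sub>v n"
    and eq: "B *\<^sub>v v = s \<cdot>\<^sub>v v" and i: "i < n"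
  shows "v $ i > 0"
proof -
  let ?S = "{i\<in>{0..<n}. v $ i > 0}"
  have "\<exists>l<n. v $ l \<noteq> 0" using v by (metis carrier_vecD eq_vecI index_zero_vec)
  then have ne: "?S \<noteq> {}" using v(2) by (auto simp: order_less_le)
  have "?S = {0..<n}"
  proof (rule ccontr)
    assume "?S \<noteq> {0..<n}"
    then obtain k j where kj: "k \<in> {0..<n} - ?S" "j \<in> ?S" "B $$ (k, j) \<noteq> 0"
      using connects[of ?S] ne by blast
    then have "(B *\<^sub>v v) $ k > 0" using v by (intro mult_pos[of v k j]) auto
    moreover have "v $ k = 0" using kj v(2)[of k] by auto
    ultimately show False using kj v(1) unfolding eq by auto
  qed
  then show ?thesis using i by (auto simp: set_eq_iff)
qed

text \<open>The triangle inequality in each row gives only an inequality for the absolute values;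
  \<open>super_eigenvector\<close> turns it into equality.\<close>

lemma abs_eigenvector:
  assumes w: "w \<in> carrier_vec n" and eq: "B *\<^sub>v w = s \<cdot>\<^sub>v w"
  shows "B *\<^sub>v map_vec abs w = s \<cdot>\<^sub>v map_vec abs w"
proof (rule super_eigenvector)
  fix i assume i: "i < n"
  have "s * \<bar>w $ i\<bar> \<le> \<bar>s * w $ i\<bar>" by (simp add: abs_mult mult_right_mono)
  also have "s * w $ i = (B *\<^sub>v w) $ i" using w i by (simp add: eq)
  also have "\<dots> = (\<Sum>j\<in>{0..<n}. B $$ (i, j) * w $ j)" using w B i by (auto simp: scalar_prod_def)
  also have "\<bar>\<dots>\<bar> \<le> (\<Sum>j\<in>{0..<n}. \<bar>B $$ (i, j) * w $ j\<bar>)" by (rule sum_abs)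
  also have "\<dots> = (B *\<^sub>v map_vec abs w) $ i"
    using w B i nonneg by (auto simp: scalar_prod_def abs_mult intro!: sum.cong)
  finally show "s * map_vec abs w $ i \<le> (B *\<^sub>v map_vec abs w) $ i" using i w by simp
qed (use w in auto)

text \<open>The absolute values form a nonnegative eigenvector, which would be positive everywhere
  if it were nonzero.\<close>

lemma eigenvector_eq_0:
  assumes w: "w \<in> carrier_vec n" and eq: "B *\<^sub>v w = s \<cdot>\<^sub>v w" and i: "i < n" "w $ i = 0"
  shows "w = 0\<^sub>v n"
proof -
  have "map_vec abs w = 0\<^sub>v n"
    using nonneg_eigenvector_pos[OF _ _ _ abs_eigenvector[OF w eq] i(1)] w i by fastforce
  then have "\<bar>w $ j\<bar> = 0" if "j < n" for j using that w
    by (metis carrier_vecD index_map_vec(1) index_zero_vec(1))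
  then show ?thesis using w by (intro eq_vecI) auto
qed

text \<open>Subtracting the multiple of \<open>p\<close> that cancels coordinate 0 leaves a vector
  to which \<open>eigenvector_eq_0\<close> applies. The same lemma ensures
  \<open>p $ 0 \<noteq> 0\<close>.\<close>

lemma eigenvector_multiple:
  assumes p: "p \<in> carrier_vec n" "B *\<^sub>v p = s \<cdot>\<^sub>v p" "p \<noteq> 0\<^sub>v n"
    and w: "w \<in> carrier_vec n" "B *\<^sub>v w = s \<cdot>\<^sub>v w"
  shows "\<exists>c. w = c \<cdot>\<^sub>v p"
proof -
  have p0: "p $ 0 \<noteq> 0" using eigenvector_eq_0[OF p(1,2) n] p(3) by blast
  define c where "c = w $ 0 / p $ 0"
  have "w - c \<cdot>\<^sub>v p = 0\<^sub>v n"
  proof (rule eigenvector_eq_0)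
    have "B *\<^sub>v (w - c \<cdot>\<^sub>v p) = s \<cdot>\<^sub>v w - c \<cdot>\<^sub>v (s \<cdot>\<^sub>v p)"
      using p w B by (simp add: mult_minus_distrib_mat_vec[of _ n n] mult_mat_vec)
    then show "B *\<^sub>v (w - c \<cdot>\<^sub>v p) = s \<cdot>\<^sub>v (w - c \<cdot>\<^sub>v p)"
      using p(1) w(1) by (auto simp: algebra_simps intro!: eq_vecI)
    show "(w - c \<cdot>\<^sub>v p) $ 0 = 0" using p0 p w n by (simp add: c_def)
  qed (use p w n in auto)
  then have "(w - c \<cdot>\<^sub>v p) $ i = 0" if "i < n" for i using that by (simp only: index_zero_vec)
  then have "w $ i = c * p $ i" if "i < n" for i using that p(1) w(1) by simp
  then have "w = c \<cdot>\<^sub>v p" using p w by (intro eq_vecI) auto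
  then show ?thesis ..
qed

text \<open>Since \<open>p\<close> is an eigenvector, passing from \<open>x\<close> to
  \<open>c \<cdot>\<^sub>v p - x\<close> only reverses the sign of the defect. Since
  \<open>p\<close> is positive, a large \<open>c\<close> makes this vector nonnegative, which
  reduces the claim to \<open>super_eigenvector\<close> although \<open>x\<close> may have entries
  of any sign.\<close>

lemma sub_eigenvector:
  assumes p: "p \<in> carrier_vec n" "B *\<^sub>v p = s \<cdot>\<^sub>v p" "\<And>i. i < n \<Longrightarrow> p $ i > 0"
    and x: "x \<in> carrier_vec n" and le: "\<And>i. i < n \<Longrightarrow> (B *\<^sub>v x) $ i \<le> s * x $ i"
  shows "B *\<^sub>v x = s \<cdot>\<^sub>v x"
proof -
  have "bdd_above ((\<lambda>i. x $ i / p $ i) ` {0..<n})" by (rule bdd_above_finite) simp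
  then obtain c where c: "\<And>i. i < n \<Longrightarrow> x $ i / p $ i \<le> c"
    unfolding bdd_above_def by (metis atLeastLessThan_iff image_eqI le0)
  define v where "v = c \<cdot>\<^sub>v p - x"
  have v0: "0 \<le> v $ i" if i: "i < n" for i
  proof -
    have "x $ i \<le> c * p $ i" using c[OF i] p(3)[OF i] by (simp add: pos_divide_le_eq)
    then show ?thesis using i p(1) x by (simp add: v_def)
  qed
  have v: "v \<in> carrier_vec n" using p x by (auto simp: v_def)
  have Bv: "B *\<^sub>v v = c \<cdot>\<^sub>v (s \<cdot>\<^sub>v p) - B *\<^sub>v x"
    using p x B by (simp add: v_def mult_minus_distrib_mat_vec[of _ n n] mult_mat_vec)
  have Bvi: "(B *\<^sub>v v) $ i = c * (s * p $ i) - (B *\<^sub>v x) $ i" if "i < n" for i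
    unfolding Bv using that p(1) B x by simp
  have "B *\<^sub>v v = s \<cdot>\<^sub>v v"
  proof (rule super_eigenvector[OF v v0])
    fix i assume i: "i < n"
    then show "s * v $ i \<le> (B *\<^sub>v v) $ i"
      unfolding Bvi[OF i] using le[OF i] p(1) x by (simp add: v_def algebra_simps)
  qed
  then have "(B *\<^sub>v v) $ i = s * v $ i" if "i < n" for i using that v by simp
  then have "c * (s * p $ i) - (B *\<^sub>v x) $ i = s * (c * p $ i - x $ i)" if "i < n" for i
    using that p(1) x Bvi by (simp add: v_def del: index_mult_mat_vec)
  then have "(B *\<^sub>v x) $ i = s * x $ i" if "i < n" for i
    using that by (simp add: algebra_simps del: index_mult_mat_vec)
  then show ?thesis using B x by (intro eq_vecI) (auto simp del: index_mult_mat_vec)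
qed

end

section \<open>Singularity and the range monotonicity argument\<close>

lemma singular_mat_kernel:
  fixes A :: "'a :: field mat"
  assumes A: "A \<in> carrier_mat n n" and sing: "\<not> invertible_mat A"
  shows "\<exists>v. v \<in> carrier_vec n \<and> v \<noteq> 0\<^sub>v n \<and> A *\<^sub>v v = 0\<^sub>v n"
proof -
  have "det A = 0"
  proof (rule ccontr)
    assume "det A \<noteq> 0"
    \<comment> \<open>\<open>undefined\<close> fills the extension field of the record
      \<open>ring_mat\<close>.\<close>
    from det_non_zero_imp_unit[OF A this, of undefined]
    obtain C where "C \<in> carrier_mat n n" "C * A = 1\<^sub>m n" "A * C = 1\<^sub>m n"
      by (auto simp: Units_def ring_mat_def)
    then have "invertible_mat A"
      using A by (auto simp: invertible_mat_def inverts_mat_def)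
    with sing show False ..
  qed
  then show ?thesis using det_0_iff_vec_prod_zero[OF A] by blast
qed

theorem theorem1p6:
  fixes A :: "real mat" and n :: nat
  assumes "A \<in> carrier_mat n n"
    and "singular_M_matrix A"
    and "irreducible_mat A"
  shows "trivially_range_monotone A"
proof -
  note A = assms(1)
  obtain s B where B: "B \<in> carrier_mat n n" and B0: "B \<ge>\<^sub>m 0\<^sub>m n n"
    and AB: "A = s \<cdot>\<^sub>m 1\<^sub>m n - B" and sr: "spectral_radius (map_mat complex_of_real B) \<le> s"
    using assms by (auto simp: singular_M_matrix_def M_matrix_def)
  obtain w where w: "w \<in> carrier_vec n" "w \<noteq> 0\<^sub>v n" "A *\<^sub>v w = 0\<^sub>v n"
    using singular_mat_kernel[OF A] assms(2) by (auto simp: singular_M_matrix_def)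
  \<comment> \<open>A nonzero kernel vector rules out order 0, for which the spectral radius is
    unspecified.\<close>
  have n: "n > 0" using w by (cases n) auto
  interpret irreducible_nonneg_mat B n s
  proof
    show "0 \<le> B $$ (i, j)" if "i < n" "j < n" for i j
      using mat_geD[OF B0, of i j] B that by auto
    fix S assume S: "S \<subset> {0..<n}" "S \<noteq> {}"
    obtain i j where ij: "i \<in> {0..<n} - S" "j \<in> S" "A $$ (i, j) \<noteq> 0"
      using irreducible_mat_connects[OF A assms(3) S] by blast
    \<comment> \<open>The pair is off the diagonal, where \<open>A\<close> and \<open>B\<close>
      differ only in sign, so irreducibility passes from \<open>A\<close> to
      \<open>B\<close>.\<close>
    then have "i \<noteq> j" "i < n" "j < n" using S by auto
    then have "B $$ (i, j) \<noteq> 0" using ij(3) B by (simp add: AB)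
    then show "\<exists>i\<in>{0..<n} - S. \<exists>j\<in>S. B $$ (i, j) \<noteq> 0" using ij by blast
  qed (use B n sr in auto)
  have Av: "A *\<^sub>v v = s \<cdot>\<^sub>v v - B *\<^sub>v v" if "v \<in> carrier_vec n" for v
  proof -
    have "A *\<^sub>v v = (s \<cdot>\<^sub>m 1\<^sub>m n) *\<^sub>v v - B *\<^sub>v v"
      unfolding AB using B that by (intro minus_mult_distrib_mat_vec) auto
    also have "(s \<cdot>\<^sub>m 1\<^sub>m n) *\<^sub>v v = s \<cdot>\<^sub>v v"
      using that by (intro eq_vecI) auto
    finally show ?thesis .
  qed
  have ker: "A *\<^sub>v v = 0\<^sub>v n \<longleftrightarrow> B *\<^sub>v v = s \<cdot>\<^sub>v v" if v: "v \<in> carrier_vec n" for v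
  proof -
    have "B *\<^sub>v v \<in> carrier_vec n" using B v by auto
    then show ?thesis unfolding Av[OF v] using v
      by (auto simp: vec_eq_iff simp del: index_mult_mat_vec)
  qed
  define p where "p = map_vec abs w"
  have p: "p \<in> carrier_vec n" "B *\<^sub>v p = s \<cdot>\<^sub>v p"
    using abs_eigenvector w by (auto simp: p_def ker)
  have "p \<noteq> 0\<^sub>v n" using w by (auto simp: p_def vec_eq_iff)
  then have p_pos: "p $ i > 0" if "i < n" for i
    using nonneg_eigenvector_pos[OF p(1) _ _ p(2)] that w by (auto simp: p_def)
  \<comment> \<open>This is proved for arbitrary \<open>v\<close> because it is applied twice: to
    \<open>x\<close>, and then to \<open>z\<close> or \<open>- z\<close>, where \<open>z\<close> is
    a preimage of \<open>x\<close>.\<close>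
  have mono: "A *\<^sub>v v = 0\<^sub>v n" if v: "v \<in> carrier_vec n" and ge: "A *\<^sub>v v \<ge> 0\<^sub>v n" for v
  proof -
    have Bv: "B *\<^sub>v v \<in> carrier_vec n" using B v by auto
    have "(B *\<^sub>v v) $ i \<le> s * v $ i" if i: "i < n" for i
      using ge i v Bv B unfolding Av[OF v] by (auto simp: less_eq_vec_def simp del: index_mult_mat_vec)
    then have "B *\<^sub>v v = s \<cdot>\<^sub>v v" by (intro sub_eigenvector[OF p p_pos v])
    then show ?thesis by (simp add: ker v)
  qed
  show ?thesis
    unfolding trivially_range_monotone_def
  proof (intro ballI impI)
    fix x assume "x \<in> range_space A" and ge: "A *\<^sub>v x \<ge> 0\<^sub>v (dim_row A)"
    then obtain z where z: "z \<in> carrier_vec n" and xz: "x = A *\<^sub>v z"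
      using A by (auto simp: range_space_def)
    have x: "x \<in> carrier_vec n" using A z by (auto simp: xz)
    have "B *\<^sub>v x = s \<cdot>\<^sub>v x" using mono[OF x] ge A by (simp add: ker[OF x])
    then obtain c where c: "x = c \<cdot>\<^sub>v p"
      using eigenvector_multiple[OF p \<open>p \<noteq> 0\<^sub>v n\<close> x] by blast
    have "x = 0\<^sub>v n"
    \<comment> \<open>As \<open>p\<close> is positive, the sign of \<open>c\<close> is the common
      sign of all entries of \<open>x\<close>.\<close>
    proof (cases "c \<ge> 0")
      case True
      then have "x \<ge> 0\<^sub>v n" using p(1) p_pos by (auto simp: c less_eq_vec_def less_imp_le)
      then show ?thesis using mono[OF z] by (simp add: xz)
    next
      case False
      have neg: "A *\<^sub>v (- z) = - x" using A z by (intro eq_vecI) (auto simp: xz)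
      have "- x \<ge> 0\<^sub>v n" using False p(1) p_pos
        by (auto simp: c less_eq_vec_def less_imp_le mult_nonpos_nonneg)
      then have "- x = 0\<^sub>v n" using mono[of "- z"] z by (simp add: neg)
      then show ?thesis using x by (metis uminus_uminus_vec uminus_zero_vec)
    qed
    then show "x = 0\<^sub>v (dim_row A)" using A by simp
  qed
qed

end
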